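(* Let $F_1, F_2, \ldots, F_k$ be graphs with a common vertex set $V$ of size $n$ such that $\delta(F_i) \ge \delta \ge 1$ for every $i$, where $\delta$ is an integer. Let $G = G(F_1,\ldots,F_k)$ be the combined graph and let $\overline{d} = \overline{d}(G)$ be its average degree. Then the following hold. (a) $\gamma_{\rm sd}(F_1,F_2,\ldots,F_k) \le \tau_{\delta-1}(G) = n - \alpha_{\delta-1}(G)$. (b) $\displaystyle \gamma_{\rm sd}(F_1,F_2,\ldots,F_k) \le \left( \frac{\lceil \overline{d} \rceil}{\lceil \overline{d} \rceil + \delta} \right) n$. (c) If in addition each of $F_1, F_2, \ldots, F_k$ is regular of degree $\delta$, then $\displaystyle \gamma_{\rm sd}(F_1,F_2,\ldots,F_k) \le \left( \frac{k}{k+1} \right) n$.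
   Context: All graphs are finite and simple. Given graphs $F_1,\ldots,F_k$ (called factors; not necessarily edge-disjoint) with common vertex set $V$, the combined graph $G(F_1,\ldots,F_k)$ has vertex set $V$ and edge set $\bigcup_{i=1}^k E(F_i)$. A dominating set of a graph is a set $S$ of vertices such that every vertex outside $S$ is adjacent to some vertex in $S$. A set $S \subseteq V$ is a simultaneous dominating set (SD-set) if $S$ is a dominating set in each $F_i$, $1 \le i \le k$. The simultaneous domination number $\gamma_{\rm sd}(F_1,\ldots,F_k)$ is the minimum cardinality of an SD-set. $\delta(F_i)$ denotes the minimum degree of $F_i$, and the average degree of a graph with $n$ vertices and $m$ edges is $2m/n$. For an integer $t \ge 0$, a $t$-vertex cover in $G$ is a set $S$ of vertices such that the subgraph $G[V \setminus S]$ has maximum degree at most $t$; $\tau_t(G)$ is the minimum cardinality of a $t$-vertex cover. A $t$-independent set in $G$ is a set $S$ of vertices such that $G[S]$ has maximum degree at most $t$; $\alpha_t(G)$ is the maximum cardinality of a $t$-independent set. *)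

theory Defs
  imports Complex_Main
begin

datatype 'a graph = Graph (verts: "'a set") (edges: "'a set set")

definition simple_graph :: "'a graph \<Rightarrow> bool" where
  "simple_graph G \<longleftrightarrow>
     finite (verts G) \<and> (\<forall>e\<in>edges G. e \<subseteq> verts G \<and> card e = 2)"

definition degree :: "'a graph \<Rightarrow> 'a \<Rightarrow> nat" where
  "degree G v = card {e \<in> edges G. v \<in> e}"

(* The minimum and the maximum degree of the graph without vertices are 0.  For the minimum
   this means that a positive lower bound on it forces the vertex set to be nonempty; for the
   maximum, that the whole vertex set is a t-vertex cover and the empty set is t-independent. *)

definition min_degree :: "'a graph \<Rightarrow> nat" where
  "min_degree G = (if verts G = {} then 0 else Min (degree G ` verts G))"

definition max_degree :: "'a graph \<Rightarrow> nat" where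
  "max_degree G = (if verts G = {} then 0 else Max (degree G ` verts G))"

definition average_degree :: "'a graph \<Rightarrow> real" where
  "average_degree G = 2 * real (card (edges G)) / real (card (verts G))"

definition regular :: "'a graph \<Rightarrow> nat \<Rightarrow> bool" where
  "regular G r \<longleftrightarrow> (\<forall>v\<in>verts G. degree G v = r)"

definition induced_subgraph :: "'a graph \<Rightarrow> 'a set \<Rightarrow> 'a graph" where
  "induced_subgraph G S = Graph S {e \<in> edges G. e \<subseteq> S}"

definition dominating_set :: "'a graph \<Rightarrow> 'a set \<Rightarrow> bool" where
  "dominating_set G S \<longleftrightarrow>
     S \<subseteq> verts G \<and> (\<forall>v\<in>verts G - S. \<exists>u\<in>S. {u, v} \<in> edges G)"

definition vertex_cover :: "nat \<Rightarrow> 'a graph \<Rightarrow> 'a set \<Rightarrow> bool" where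
  "vertex_cover t G S \<longleftrightarrow>
     S \<subseteq> verts G \<and> max_degree (induced_subgraph G (verts G - S)) \<le> t"

definition vertex_cover_number :: "nat \<Rightarrow> 'a graph \<Rightarrow> nat" where
  "vertex_cover_number t G = Min (card ` {S. vertex_cover t G S})"

definition independent_set :: "nat \<Rightarrow> 'a graph \<Rightarrow> 'a set \<Rightarrow> bool" where
  "independent_set t G S \<longleftrightarrow>
     S \<subseteq> verts G \<and> max_degree (induced_subgraph G S) \<le> t"

definition independence_number :: "nat \<Rightarrow> 'a graph \<Rightarrow> nat" where
  "independence_number t G = Max (card ` {S. independent_set t G S})"

(* Families of factors are F 1, ..., F k; values of F at other indices are irrelevant. *)

definition combined_graph :: "'a set \<Rightarrow> nat \<Rightarrow> (nat \<Rightarrow> 'a graph) \<Rightarrow> 'a graph" where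
  "combined_graph V k F = Graph V (\<Union>i\<in>{1..k}. edges (F i))"

definition sd_set :: "'a set \<Rightarrow> nat \<Rightarrow> (nat \<Rightarrow> 'a graph) \<Rightarrow> 'a set \<Rightarrow> bool" where
  "sd_set V k F S \<longleftrightarrow> S \<subseteq> V \<and> (\<forall>i\<in>{1..k}. dominating_set (F i) S)"

definition sd_number :: "'a set \<Rightarrow> nat \<Rightarrow> (nat \<Rightarrow> 'a graph) \<Rightarrow> nat" where
  "sd_number V k F = Min (card ` {S. sd_set V k F S})"

end

(* Part (a): a vertex outside a (\<delta> - 1)-vertex cover S has at most \<delta> - 1 neighbours outside S, hence in
   each factor a neighbour in S.

   Part (b) is the lower bound \<alpha> >= \<delta> n / (d + \<delta>) for the (\<delta> - 1)-independence number of a graph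
   with n vertices, m edges and average degree d.  Interpolate the right-hand side linearly
   between consecutive multiples (q - 1) \<delta> and q \<delta> of \<delta>; by convexity it suffices to show
   \<delta> q (q + 1) \<alpha> >= 2 (q \<delta> n - m) for all q >= 1.  Deleting a vertex of degree at least q \<delta> does
   not decrease the right-hand side.  If no such vertex exists, a q-colouring with the fewest
   monochromatic edges has (\<delta> - 1)-independent classes (Lovasz), so \<alpha> >= n / q, which is enough
   when d >= (q - 1) \<delta>; for smaller d the inequality for q - 1 is the stronger one.

   Part (c) follows since the combined graph then has average degree at most k \<delta>. *)

theory Submission
  imports Defs
begin

section \<open>Simple graphs, induced subgraphs and edge counts\<close>

lemma simple_graph_finite_edges:
  assumes "simple_graph G"
  shows "finite (edges G)"
proof -
  have "edges G \<subseteq> Pow (verts G)" "finite (verts G)"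
    using assms by (auto simp: simple_graph_def)
  then show ?thesis by (meson finite_Pow_iff finite_subset)
qed

lemma simple_graph_edgeE:
  assumes "simple_graph G" "e \<in> edges G" "v \<in> e"
  obtains u where "u \<noteq> v" "e = {v, u}" "u \<in> verts G"
proof -
  have e: "card e = 2" "e \<subseteq> verts G"
    using assms by (auto simp: simple_graph_def)
  then obtain x y where "e = {x, y}" "x \<noteq> y" by (auto simp: card_2_iff)
  moreover from this assms(3) have "v = x \<or> v = y" by simp
  ultimately show ?thesis using e(2) that[of x] that[of y] by (auto simp: insert_commute)
qed

lemma simple_graph_induced_subgraph:
  assumes "simple_graph G" "S \<subseteq> verts G"
  shows "simple_graph (induced_subgraph G S)"
  using assms finite_subset by (auto simp: simple_graph_def induced_subgraph_def)

lemma degree_induced_subgraph: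
  "degree (induced_subgraph G S) v = card {e \<in> edges G. e \<subseteq> S \<and> v \<in> e}"
  unfolding degree_def induced_subgraph_def by (rule arg_cong[where f = card]) auto

lemma max_degree_le_iff:
  assumes "finite (verts G)"
  shows "max_degree G \<le> t \<longleftrightarrow> (\<forall>v\<in>verts G. degree G v \<le> t)"
  using assms by (auto simp: max_degree_def)

text \<open>Trades the maximum degree, with its convention for the empty graph, for a bound at each
  vertex, counted by edges of \<open>G\<close> itself.\<close>

lemma independent_set_iff:
  assumes "finite (verts G)"
  shows "independent_set t G S \<longleftrightarrow>
    S \<subseteq> verts G \<and> (\<forall>v\<in>S. card {e \<in> edges G. e \<subseteq> S \<and> v \<in> e} \<le> t)"
proof (cases "S \<subseteq> verts G")
  case True
  then have "finite (verts (induced_subgraph G S))"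
    using assms finite_subset by (auto simp: induced_subgraph_def)
  from max_degree_le_iff[OF this] show ?thesis
    by (simp add: independent_set_def degree_induced_subgraph) (simp add: induced_subgraph_def)
qed (simp add: independent_set_def)

text \<open>Edges inside \<open>S\<close> are the same in \<open>G\<close> and in the induced
  subgraph. This carries a solution back after a vertex has been deleted.\<close>

lemma independent_set_induced_subgraph:
  assumes "finite (verts G)" "W \<subseteq> verts G" "independent_set t (induced_subgraph G W) S"
  shows "independent_set t G S"
proof -
  have W: "finite (verts (induced_subgraph G W))"
    using assms finite_subset by (auto simp: induced_subgraph_def)
  have S: "S \<subseteq> W"
    using assms(3) by (simp add: independent_set_def) (simp add: induced_subgraph_def)
  then have "{e \<in> edges (induced_subgraph G W). e \<subseteq> S \<and> v \<in> e} = {e \<in> edges G. e \<subseteq> S \<and> v \<in> e}"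
    for v by (auto simp: induced_subgraph_def)
  then show ?thesis
    using assms S by (auto simp: independent_set_iff[OF W] independent_set_iff[OF assms(1)])
qed

lemma card_edges_delete_vertex:
  assumes "simple_graph G"
  shows "card (edges G) = card (edges (induced_subgraph G (verts G - {v}))) + degree G v"
proof -
  have "edges G = edges (induced_subgraph G (verts G - {v})) \<union> {e \<in> edges G. v \<in> e}"
    and d: "edges (induced_subgraph G (verts G - {v})) \<inter> {e \<in> edges G. v \<in> e} = {}"
    using assms by (auto simp: simple_graph_def induced_subgraph_def)
  moreover have "finite (edges G)" using assms by (rule simple_graph_finite_edges)
  ultimately show ?thesis
    unfolding degree_def by (metis card_Un_disjoint finite_Un)
qed

text \<open>Handshaking lemma, by double counting of incidences.\<close>

lemma sum_degree_eq:
  assumes "simple_graph G"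
  shows "(\<Sum>v\<in>verts G. degree G v) = 2 * card (edges G)"
proof -
  have fin: "finite (verts G)" "finite (edges G)"
    using assms by (auto simp: simple_graph_def intro: simple_graph_finite_edges[OF assms])
  have "(\<Sum>v\<in>verts G. degree G v) = (\<Sum>e\<in>edges G. card {v \<in> verts G. v \<in> e})"
    unfolding degree_def using sum_multicount_gen[OF fin, of "\<lambda>v e. v \<in> e"] by auto
  also have "\<dots> = (\<Sum>e\<in>edges G. 2)"
  proof (rule sum.cong)
    fix e assume "e \<in> edges G"
    then have "{v \<in> verts G. v \<in> e} = e" "card e = 2"
      using assms by (auto simp: simple_graph_def)
    then show "card {v \<in> verts G. v \<in> e} = 2" by simp
  qed simp
  finally show ?thesis by simp
qed

section \<open>Colourings with few monochromatic edges and large independent sets\<close>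

text \<open>Take \<open>c\<close> with the fewest monochromatic edges. At a vertex of degree below
  \<open>q * t\<close> some colour occurs on fewer than \<open>t\<close> neighbours; switching to it
  cannot lower the count, so the vertex's own colour occurs no more often.\<close>

lemma ex_coloring_small_class_degree:
  fixes G :: "'a graph" and q t :: nat
  assumes G: "simple_graph G" and deg: "\<And>v. v \<in> verts G \<Longrightarrow> degree G v < q * t"
  obtains c :: "'a \<Rightarrow> nat"
  where "c ` verts G \<subseteq> {..<q}"
    and "\<forall>v\<in>verts G. card {e \<in> edges G. v \<in> e \<and> (\<forall>x\<in>e. c x = c v)} < t"
proof (cases "verts G = {}")
  case True
  then show ?thesis using that by auto
next
  case False
  then have q: "0 < q" using deg by fastforce
  have fE: "finite (edges G)" using G by (rule simple_graph_finite_edges)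
  define mono where "mono c = {e \<in> edges G. \<forall>x\<in>e. \<forall>y\<in>e. c x = c y}" for c :: "'a \<Rightarrow> nat"
  define col where "col c \<longleftrightarrow> c ` verts G \<subseteq> {..<q}" for c :: "'a \<Rightarrow> nat"
  have "col (\<lambda>_. 0)" using q by (auto simp: col_def)
  then obtain c where c: "col c" and min: "\<And>c'. col c' \<Longrightarrow> card (mono c) \<le> card (mono c')"
    using ex_has_least_nat[of col _ "\<lambda>c. card (mono c)"] by blast
  show ?thesis
  proof (rule that[of c])
    show "c ` verts G \<subseteq> {..<q}" using c by (simp add: col_def)
    show "\<forall>v\<in>verts G. card {e \<in> edges G. v \<in> e \<and> (\<forall>x\<in>e. c x = c v)} < t"
    proof
      fix v assume v: "v \<in> verts G"
      \<comment> \<open>\<open>M j\<close> consists of the edges from \<open>v\<close> to neighbours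
        of colour \<open>j\<close>. Removing \<open>v\<close> from \<open>e\<close> makes it
        independent of the colour of \<open>v\<close>.\<close>
      define M where "M j = {e \<in> edges G. v \<in> e \<and> (\<forall>x\<in>e - {v}. c x = j)}" for j
      have fM: "finite (M j)" for j using fE by (simp add: M_def)
      have M_disj: "M i \<inter> M j = {}" if "i \<noteq> j" for i j
      proof (rule ccontr)
        assume "M i \<inter> M j \<noteq> {}"
        then obtain e where e: "e \<in> M i" "e \<in> M j" by blast
        then have "e \<in> edges G" "v \<in> e" by (simp_all add: M_def)
        then obtain u where "u \<noteq> v" "e = {v, u}" using simple_graph_edgeE[OF G] by metis
        then show False using e that by (simp add: M_def)
      qed
      have "{e \<in> edges G. v \<in> e} = (\<Union>j<q. M j)"
      proof (intro equalityI subsetI)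
        fix e assume e: "e \<in> {e \<in> edges G. v \<in> e}"
        then obtain u where u: "u \<noteq> v" "e = {v, u}" "u \<in> verts G"
          using simple_graph_edgeE[OF G] by (metis mem_Collect_eq)
        with c e have "c u < q" "e \<in> M (c u)" by (auto simp: M_def col_def)
        then show "e \<in> (\<Union>j<q. M j)" by blast
      qed (auto simp: M_def)
      then have "degree G v = (\<Sum>j<q. card (M j))"
        unfolding degree_def using fM M_disj by (simp add: card_UN_disjoint)
      then have "(\<Sum>j<q. card (M j)) < q * t" using deg[OF v] by simp
      then obtain j where j: "j < q" "card (M j) < t"
        using sum_bounded_below[of "{..<q}" t "\<lambda>j. card (M j)"] by (force simp: not_less)
      \<comment> \<open>\<open>R\<close> is unaffected by recolouring \<open>v\<close>, so two
        colourings that differ only at \<open>v\<close> are compared through \<open>M\<close>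
        alone.\<close>
      define R where "R = {e \<in> mono c. v \<notin> e}"
      have fR: "finite R" using fE by (simp add: R_def mono_def)
      have split: "mono (c(v := i)) = R \<union> M i" for i
      proof -
        have "e \<in> mono (c(v := i)) \<longleftrightarrow> e \<in> R \<union> M i" if e: "e \<in> edges G" for e
        proof (cases "v \<in> e")
          case True
          then obtain u where "u \<noteq> v" "e = {v, u}" using e simple_graph_edgeE[OF G] by metis
          then show ?thesis using e by (auto simp: mono_def R_def M_def)
        next
          case False
          then have "\<forall>x\<in>e. (c(v := i)) x = c x" by auto
          then show ?thesis using False by (simp add: mono_def R_def M_def)
        qed
        moreover have "mono (c(v := i)) \<subseteq> edges G" "R \<union> M i \<subseteq> edges G"
          unfolding mono_def R_def M_def by blast+
        ultimately show ?thesis by blast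
      qed
      have disj: "R \<inter> M i = {}" for i by (auto simp: R_def M_def)
      have "col (c(v := j))" using c j by (auto simp: col_def)
      \<comment> \<open>The update \<open>c(v := c v)\<close> is just \<open>c\<close>, written so
        that \<open>split\<close> rewrites both sides.\<close>
      from min[OF this] have "card (mono (c(v := c v))) \<le> card (mono (c(v := j)))" by simp
      then have "card (M (c v)) \<le> card (M j)"
        unfolding split by (simp add: card_Un_disjoint[OF fR fM disj])
      moreover have "card {e \<in> edges G. v \<in> e \<and> (\<forall>x\<in>e. c x = c v)} \<le> card (M (c v))"
        by (rule card_mono[OF fM]) (auto simp: M_def)
      ultimately show "card {e \<in> edges G. v \<in> e \<and> (\<forall>x\<in>e. c x = c v)} < t" using j by simp
    qed
  qed
qed

text \<open>By averaging, one of the \<open>q\<close> colour classes contains at least a fraction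
  \<open>1 / q\<close> of the vertices.\<close>

lemma ex_independent_set_of_degree_bound:
  fixes G :: "'a graph" and q t :: nat
  assumes G: "simple_graph G" and q: "1 \<le> q"
    and deg: "\<And>v. v \<in> verts G \<Longrightarrow> degree G v < q * t"
  shows "\<exists>S. independent_set (t - 1) G S \<and> card (verts G) \<le> q * card S"
proof -
  have fV: "finite (verts G)" using G by (simp add: simple_graph_def)
  have fE: "finite (edges G)" using G by (rule simple_graph_finite_edges)
  obtain c where c: "c ` verts G \<subseteq> {..<q}"
    and small: "\<forall>v\<in>verts G. card {e \<in> edges G. v \<in> e \<and> (\<forall>x\<in>e. c x = c v)} < t"
    by (rule ex_coloring_small_class_degree[OF G deg])
  define C where "C j = {v \<in> verts G. c v = j}" for j
  have "verts G = (\<Union>j<q. C j)" using c by (auto simp: C_def)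
  then have card: "card (verts G) = (\<Sum>j<q. card (C j))"
    using fV by (subst card_UN_disjoint[symmetric]) (auto simp: C_def)
  have "\<exists>j<q. card (verts G) \<le> q * card (C j)"
  proof (rule ccontr)
    assume "\<not> ?thesis"
    then have "(\<Sum>j<q. q * card (C j)) < (\<Sum>j<q. card (verts G))"
      using q by (intro sum_strict_mono) (auto simp: lessThan_empty_iff)
    then show False using card by (simp add: sum_distrib_left[symmetric])
  qed
  then obtain j where j: "card (verts G) \<le> q * card (C j)" by blast
  have "card {e \<in> edges G. e \<subseteq> C j \<and> v \<in> e} \<le> t - 1" if "v \<in> C j" for v
  proof -
    have "{e \<in> edges G. e \<subseteq> C j \<and> v \<in> e} \<subseteq> {e \<in> edges G. v \<in> e \<and> (\<forall>x\<in>e. c x = c v)}"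
      by (auto simp: C_def)
    from card_mono[OF _ this] show ?thesis
      using fE small that by (auto simp: C_def)
  qed
  then have "independent_set (t - 1) G (C j)"
    by (auto simp: independent_set_iff[OF fV] C_def)
  then show ?thesis using j by blast
qed

text \<open>With \<open>n\<close> vertices, \<open>m\<close> edges and
  \<open>x = 2 m / (t n)\<close>, this reads
  \<open>card S / n \<ge> (2 q - x) / (q (q + 1))\<close>. The right-hand side is the chord of
  \<open>1 / (x + 1)\<close> between \<open>x = q - 1\<close> and \<open>x = q\<close>. Keeping the
  edge term on the right avoids subtraction of naturals.\<close>

lemma ex_independent_set_linear_bound:
  fixes G :: "'a graph" and q t :: nat
  assumes "simple_graph G" "1 \<le> t" "1 \<le> q"
  shows "\<exists>S. independent_set (t - 1) G S \<and>
    2 * q * t * card (verts G) \<le> t * q * (q + 1) * card S + 2 * card (edges G)"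
  using assms
\<comment> \<open>One reduction deletes a vertex and keeps \<open>q\<close>, the other keeps the
  graph and lowers \<open>q\<close>; the sum decreases in both.\<close>
proof (induction "card (verts G) + q" arbitrary: G q rule: less_induct)
  case less
  note G = \<open>simple_graph G\<close>
  have fV: "finite (verts G)" using G by (simp add: simple_graph_def)
  show ?case
  proof (cases "\<exists>v\<in>verts G. q * t \<le> degree G v")
    case True
    then obtain v where v: "v \<in> verts G" "q * t \<le> degree G v" by blast
    let ?H = "induced_subgraph G (verts G - {v})"
    have card: "card (verts G) = Suc (card (verts ?H))"
      using card_Suc_Diff1[OF fV v(1)] by (simp only: induced_subgraph_def graph.sel)
    have "simple_graph ?H" using G by (intro simple_graph_induced_subgraph) auto
    then obtain S where S: "independent_set (t - 1) ?H S"
      "2 * q * t * card (verts ?H) \<le> t * q * (q + 1) * card S + 2 * card (edges ?H)"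
      using less card by force
    have "independent_set (t - 1) G S"
      using independent_set_induced_subgraph[OF fV _ S(1)] by simp
    \<comment> \<open>Restoring \<open>v\<close> adds \<open>2 * q * t\<close> on the left and
      \<open>2 * degree G v\<close>, which is at least as much, on the right.\<close>
    moreover have "2 * q * t * card (verts G) \<le> t * q * (q + 1) * card S + 2 * card (edges G)"
      using S(2) v(2) unfolding card card_edges_delete_vertex[OF G, of v]
      by (simp add: algebra_simps)
    ultimately show ?thesis by blast
  next
    case False
    show ?thesis
    proof (cases "(q - 1) * t * card (verts G) \<le> 2 * card (edges G)")
      case True
      obtain S where S: "independent_set (t - 1) G S" "card (verts G) \<le> q * card S"
        using ex_independent_set_of_degree_bound[OF G \<open>1 \<le> q\<close>, of t] False by (meson not_le)
      obtain p where p: "q = Suc p" using \<open>1 \<le> q\<close> by (cases q) auto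
      \<comment> \<open>The left-hand side of the goal splits as
        \<open>2 q = (q + 1) + (q - 1)\<close>: the first part is paid for by \<open>S\<close>, the
        second by the edges.\<close>
      have "t * (q + 1) * card (verts G) \<le> t * (q + 1) * (q * card S)"
        using S(2) by (rule mult_le_mono2)
      then have "2 * q * t * card (verts G) \<le> t * q * (q + 1) * card S + 2 * card (edges G)"
        using True unfolding p by (simp add: algebra_simps)
      then show ?thesis using S(1) by blast
    next
      case few: False
      \<comment> \<open>For \<open>q = 1\<close> the left-hand side of the negated inequality would
        be 0, so \<open>q - 1\<close> is again an admissible parameter.\<close>
      then obtain p where p: "q = Suc p" "1 \<le> p" by (cases q; cases "q - 1") auto
      have "card (verts G) + p < card (verts G) + q" using p by simp
      from less(1)[OF this G \<open>1 \<le> t\<close> \<open>1 \<le> p\<close>] obtain S where S: "independent_set (t - 1) G S"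
        "2 * p * t * card (verts G) \<le> t * p * (p + 1) * card S + 2 * card (edges G)" by blast
      \<comment> \<open>The factor \<open>p + 2\<close> makes the coefficient of
        \<open>card S\<close> equal to \<open>p\<close> times the one wanted for
        \<open>q = p + 1\<close>. What remains is \<open>4 m \<le> 2 p t n\<close>, which follows
        from \<open>few\<close>.\<close>
      have "(p + 2) * (2 * p * t * card (verts G)) \<le>
          (p + 2) * (t * p * (p + 1) * card S + 2 * card (edges G))"
        using S(2) by (rule mult_le_mono2)
      moreover have "2 * card (edges G) \<le> p * t * card (verts G)" using few p by simp
      ultimately have "p * (2 * q * t * card (verts G)) \<le>
          p * (t * q * (q + 1) * card S + 2 * card (edges G))"
        unfolding p by (simp add: algebra_simps)
      then have "2 * q * t * card (verts G) \<le> t * q * (q + 1) * card S + 2 * card (edges G)"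
        using p(2) by simp
      then show ?thesis using S(1) by blast
    qed
  qed
qed

section \<open>Vertex covers as complements of independent sets\<close>

lemma finite_vertex_covers: "finite (verts G) \<Longrightarrow> finite {S. vertex_cover t G S}"
  by (rule finite_subset[of _ "Pow (verts G)"]) (auto simp: vertex_cover_def)

lemma finite_independent_sets: "finite (verts G) \<Longrightarrow> finite {S. independent_set t G S}"
  by (rule finite_subset[of _ "Pow (verts G)"]) (auto simp: independent_set_def)

lemma vertex_cover_verts: "vertex_cover t G (verts G)"
  by (simp add: vertex_cover_def induced_subgraph_def max_degree_def)

lemma independent_set_empty: "independent_set t G {}"
  by (simp add: independent_set_def induced_subgraph_def max_degree_def)

lemma vertex_cover_iff_independent_set:
  assumes "S \<subseteq> verts G"
  shows "vertex_cover t G S \<longleftrightarrow> independent_set t G (verts G - S)"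
  using assms by (auto simp: vertex_cover_def independent_set_def)

text \<open>The complement of a largest independent set is a cover, and the complement of a smallest
  cover is independent; each gives one inequality.\<close>

lemma vertex_cover_number_add_independence_number:
  assumes fin: "finite (verts G)"
  shows "vertex_cover_number t G + independence_number t G = card (verts G)"
proof (rule antisym)
  let ?\<tau> = "vertex_cover_number t G" and ?\<alpha> = "independence_number t G"
  have "?\<alpha> \<in> card ` {S. independent_set t G S}"
    unfolding independence_number_def using finite_independent_sets[OF fin] independent_set_empty
    by (intro Max_in) auto
  then obtain I where I: "independent_set t G I" "card I = ?\<alpha>" by auto
  then have sub: "I \<subseteq> verts G" by (simp add: independent_set_def)
  then have "vertex_cover t G (verts G - I)"
    using I by (simp add: vertex_cover_iff_independent_set double_diff)
  then have "?\<tau> \<le> card (verts G - I)"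
    unfolding vertex_cover_number_def using finite_vertex_covers[OF fin] by (intro Min_le) auto
  then show "?\<tau> + ?\<alpha> \<le> card (verts G)"
    using I sub fin card_mono[OF fin sub]
    by (simp add: card_Diff_subset finite_subset le_diff_conv2)
next
  let ?\<tau> = "vertex_cover_number t G" and ?\<alpha> = "independence_number t G"
  have "?\<tau> \<in> card ` {S. vertex_cover t G S}"
    unfolding vertex_cover_number_def using finite_vertex_covers[OF fin] vertex_cover_verts
    by (intro Min_in) auto
  then obtain C where C: "vertex_cover t G C" "card C = ?\<tau>" by auto
  then have sub: "C \<subseteq> verts G" by (simp add: vertex_cover_def)
  then have "independent_set t G (verts G - C)"
    using C by (simp add: vertex_cover_iff_independent_set)
  then have "card (verts G - C) \<le> ?\<alpha>"
    unfolding independence_number_def using finite_independent_sets[OF fin] by (intro Max_ge) auto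
  then show "card (verts G) \<le> ?\<tau> + ?\<alpha>"
    using C sub fin by (simp add: card_Diff_subset finite_subset)
qed

section \<open>Lower bound for the independence number in terms of the average degree\<close>

text \<open>In terms of \<open>x = d / t\<close> the fraction on the left is
  \<open>1 / (x + 1)\<close>. By convexity it is at most the chord over the unit interval containing
  \<open>x\<close>, and that chord is the linear bound for a suitable \<open>q\<close>.\<close>

lemma independence_number_ge:
  fixes G :: "'a graph" and t :: nat
  assumes G: "simple_graph G" and t: "1 \<le> t" and ne: "verts G \<noteq> {}"
  shows "real t / (average_degree G + real t) * real (card (verts G))
    \<le> real (independence_number (t - 1) G)"
proof -
  define d where "d = average_degree G"
  define n where "n = real (card (verts G))"
  define x where "x = d / real t"
  \<comment> \<open>Chosen so that \<open>x\<close> lies between \<open>q - 1\<close> and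
    \<open>q\<close>; the successor also ensures \<open>1 \<le> q\<close> when
    \<open>x < 1\<close>.\<close>
  define q where "q = Suc (nat \<lfloor>x\<rfloor>)"
  define s where "s = real (independence_number (t - 1) G)"
  have fV: "finite (verts G)" using G by (simp add: simple_graph_def)
  have n: "0 < n" using ne fV by (simp add: n_def card_gt_0_iff)
  have x: "0 \<le> x" by (simp add: x_def d_def average_degree_def)
  have e: "2 * real (card (edges G)) = x * t * n"
    using n t by (simp add: x_def d_def average_degree_def n_def)
  have q: "x \<le> q" "q \<le> x + 1" using x unfolding q_def by linarith+
  obtain S where S: "independent_set (t - 1) G S"
    "2 * q * t * card (verts G) \<le> t * q * (q + 1) * card S + 2 * card (edges G)"
    using ex_independent_set_linear_bound[OF G t, of q] by (auto simp: q_def)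
  have "card S \<le> independence_number (t - 1) G"
    unfolding independence_number_def using finite_independent_sets[OF fV] S(1)
    by (intro Max_ge) auto
  then have Ss: "real (card S) \<le> s" by (simp add: s_def)
  have "real (2 * q * t * card (verts G)) \<le> real (t * q * (q + 1) * card S + 2 * card (edges G))"
    using S(2) by (rule of_nat_mono)
  then have "t * (2 * q * n) \<le> t * (q * (q + 1) * card S + x * n)"
    using e by (simp add: n_def algebra_simps)
  then have "2 * q * n \<le> q * (q + 1) * card S + x * n"
    using t by (subst (asm) mult_le_cancel_left_pos) auto
  then have "(2 * q - x) * n \<le> q * (q + 1) * card S"
    by (simp add: algebra_simps)
  also have "\<dots> = real (q * (q + 1)) * card S" by simp
  also have "\<dots> \<le> q * (q + 1) * s" using Ss by (rule mult_left_mono) simp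
  finally have line: "(2 * q - x) * n \<le> q * (q + 1) * s" .
  \<comment> \<open>The chord of \<open>x \<mapsto> 1 / (x + 1)\<close> between \<open>q - 1\<close> and \<open>q\<close> lies above the curve.\<close>
  have "0 \<le> (q - x) * (1 - (q - x))" using q by (intro mult_nonneg_nonneg) auto
  then have "q * (q + 1) \<le> (2 * q - x) * (x + 1)" by (simp add: algebra_simps)
  then have "q * (q + 1) * n \<le> (2 * q - x) * (x + 1) * n" using n by simp
  also have "\<dots> = (2 * q - x) * n * (x + 1)" by simp
  also have "\<dots> \<le> q * (q + 1) * s * (x + 1)" using line x by (intro mult_right_mono) auto
  finally have "q * (q + 1) * n \<le> q * (q + 1) * (s * (x + 1))" by (simp only: mult.assoc)
  moreover have "0 < real (q * (q + 1))" unfolding of_nat_0_less_iff by (simp add: q_def)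
  ultimately have "n \<le> s * (x + 1)" by (simp only: mult_le_cancel_left_pos)
  then have "n / (x + 1) \<le> s" using x by (simp add: pos_divide_le_eq)
  moreover have "t / (d + t) * n = n / (x + 1)"
    using t x by (simp add: x_def field_simps)
  ultimately show ?thesis by (simp add: d_def n_def s_def)
qed

section \<open>Combined graphs and simultaneous domination\<close>

lemma simple_graph_combined_graph:
  assumes "finite V" and "\<And>i. i \<in> {1..k} \<Longrightarrow> simple_graph (F i) \<and> verts (F i) = V"
  shows "simple_graph (combined_graph V k F)"
  using assms by (fastforce simp: simple_graph_def combined_graph_def)

lemma vertex_cover_combined_graph_imp_sd_set:
  assumes fV: "finite V"
    and F: "\<And>i. i \<in> {1..k} \<Longrightarrow> simple_graph (F i) \<and> verts (F i) = V"
    and deg: "\<And>i. i \<in> {1..k} \<Longrightarrow> \<delta> \<le> min_degree (F i)" and \<delta>: "1 \<le> \<delta>"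
    and S: "vertex_cover (\<delta> - 1) (combined_graph V k F) S"
  shows "sd_set V k F S"
  unfolding sd_set_def dominating_set_def
proof (intro conjI ballI)
  let ?G = "combined_graph V k F"
  have GV: "verts ?G = V" by (simp add: combined_graph_def)
  show SV: "S \<subseteq> V" using S by (simp add: vertex_cover_def GV)
  fix i assume i: "i \<in> {1..k}"
  show "S \<subseteq> verts (F i)" using SV F[OF i] by simp
  fix v assume "v \<in> verts (F i) - S"
  then have v: "v \<in> V" "v \<notin> S" using F[OF i] by auto
  have G: "simple_graph ?G" using simple_graph_combined_graph[OF fV F] .
  have sub: "edges (F i) \<subseteq> edges ?G" using i by (auto simp: combined_graph_def)
  have "independent_set (\<delta> - 1) ?G (V - S)"
    using S SV vertex_cover_iff_independent_set[of S ?G] by (simp add: GV)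
  then have "card {e \<in> edges ?G. e \<subseteq> V - S \<and> v \<in> e} \<le> \<delta> - 1"
    using v fV by (auto simp: independent_set_iff GV)
  moreover have "card {e \<in> edges (F i). e \<subseteq> V - S \<and> v \<in> e} \<le> card {e \<in> edges ?G. e \<subseteq> V - S \<and> v \<in> e}"
    using sub simple_graph_finite_edges[OF G] by (intro card_mono) auto
  moreover have "min_degree (F i) \<le> degree (F i) v"
    using F[OF i] v fV by (auto simp: min_degree_def)
  \<comment> \<open>Strictness comes from \<open>\<delta> - 1 < \<delta>\<close>, which holds for
    truncated subtraction because \<open>1 \<le> \<delta>\<close>. Hence some edge of
    \<open>F i\<close> at \<open>v\<close> leaves \<open>V - S\<close>.\<close>
  ultimately have "card {e \<in> edges (F i). e \<subseteq> V - S \<and> v \<in> e} < card {e \<in> edges (F i). v \<in> e}"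
    using deg[OF i] \<delta> unfolding degree_def by linarith
  then have "{e \<in> edges (F i). e \<subseteq> V - S \<and> v \<in> e} \<noteq> {e \<in> edges (F i). v \<in> e}"
    by (metis less_irrefl)
  then obtain e where e: "e \<in> edges (F i)" "v \<in> e" "\<not> e \<subseteq> V - S" by blast
  moreover from e obtain u where "e = {v, u}" "u \<in> V"
    using F[OF i] by (metis simple_graph_edgeE)
  ultimately show "\<exists>u\<in>S. {u, v} \<in> edges (F i)"
    using v by (auto simp: insert_commute)
qed

lemma sd_number_le_vertex_cover_number:
  assumes fV: "finite V"
    and F: "\<And>i. i \<in> {1..k} \<Longrightarrow> simple_graph (F i) \<and> verts (F i) = V"
    and deg: "\<And>i. i \<in> {1..k} \<Longrightarrow> \<delta> \<le> min_degree (F i)" and \<delta>: "1 \<le> \<delta>"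
  shows "sd_number V k F \<le> vertex_cover_number (\<delta> - 1) (combined_graph V k F)"
proof -
  let ?G = "combined_graph V k F"
  have "finite {S. sd_set V k F S}"
    by (rule finite_subset[of _ "Pow V"]) (use fV in \<open>auto simp: sd_set_def\<close>)
  then show ?thesis
    unfolding sd_number_def vertex_cover_number_def
    \<comment> \<open>Covers form a subfamily of the SD-sets, so their minimum is the larger one;
      the full vertex set shows that the subfamily is nonempty.\<close>
    using vertex_cover_combined_graph_imp_sd_set[OF fV F deg \<delta>] vertex_cover_verts[of "\<delta> - 1" ?G]
    by (intro Min_antimono) auto
qed

text \<open>By handshaking every factor has \<open>r n / 2\<close> edges for
  \<open>n = card V\<close>. Factors may share edges, so the union bound gives only an
  inequality.\<close>

lemma average_degree_combined_graph_le:
  assumes fV: "finite V"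
    and F: "\<And>i. i \<in> {1..k} \<Longrightarrow> simple_graph (F i) \<and> verts (F i) = V"
    and reg: "\<And>i. i \<in> {1..k} \<Longrightarrow> regular (F i) r"
  shows "average_degree (combined_graph V k F) \<le> real (k * r)"
proof -
  have "2 * card (edges (F i)) = card V * r" if "i \<in> {1..k}" for i
    using sum_degree_eq[of "F i"] F[OF that] reg[OF that] by (simp add: regular_def)
  then have "(\<Sum>i\<in>{1..k}. 2 * card (edges (F i))) = k * (card V * r)" by simp
  moreover have "card (edges (combined_graph V k F)) \<le> (\<Sum>i\<in>{1..k}. card (edges (F i)))"
    unfolding combined_graph_def by (simp add: card_UN_le)
  ultimately have "2 * card (edges (combined_graph V k F)) \<le> k * r * card V"
    by (simp add: sum_distrib_left[symmetric] algebra_simps)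
  then have "real (2 * card (edges (combined_graph V k F))) \<le> real (k * r * card V)"
    by (rule of_nat_mono)
  then show ?thesis
    \<comment> \<open>For empty \<open>V\<close> the average degree is 0, by division by
      zero.\<close>
    by (cases "card V = 0") (simp_all add: average_degree_def combined_graph_def divide_le_eq)
qed

theorem theorem10:
  fixes V :: "'a set" and n k \<delta> :: nat
    and F :: "nat \<Rightarrow> 'a graph" and G :: "'a graph" and d :: real
  assumes "finite V" and "card V = n" and "1 \<le> k"
    and "\<And>i. i \<in> {1..k} \<Longrightarrow> simple_graph (F i) \<and> verts (F i) = V"
    and "1 \<le> \<delta>" and "\<And>i. i \<in> {1..k} \<Longrightarrow> \<delta> \<le> min_degree (F i)"
    and "G = combined_graph V k F" and "d = average_degree G"
  shows "(sd_number V k F \<le> vertex_cover_number (\<delta> - 1) G \<and>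
          int (vertex_cover_number (\<delta> - 1) G) = int n - int (independence_number (\<delta> - 1) G)) \<and>
         real (sd_number V k F) \<le> (of_int \<lceil>d\<rceil> / (of_int \<lceil>d\<rceil> + real \<delta>)) * real n \<and>
         ((\<forall>i\<in>{1..k}. regular (F i) \<delta>) \<longrightarrow>
            real (sd_number V k F) \<le> (real k / (real k + 1)) * real n)"
proof -
  note fV = \<open>finite V\<close> and F = assms(4) and \<delta> = \<open>1 \<le> \<delta>\<close> and deg = assms(6)
  have GV: "verts G = V" using assms(7) by (simp add: combined_graph_def)
  have G: "simple_graph G" using simple_graph_combined_graph[OF fV F] assms(7) by simp
  \<comment> \<open>The empty graph has minimum degree 0 by convention, which the factor
    \<open>F 1\<close> excludes.\<close>
  have V: "V \<noteq> {}"
    using F[of 1] deg[of 1] \<open>1 \<le> k\<close> \<delta> by (auto simp: min_degree_def split: if_splits)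
  have d: "0 \<le> d" using assms(8) by (simp add: average_degree_def)
  have a1: "sd_number V k F \<le> vertex_cover_number (\<delta> - 1) G"
    using sd_number_le_vertex_cover_number[OF fV F deg \<delta>] assms(7) by simp
  have a2: "vertex_cover_number (\<delta> - 1) G + independence_number (\<delta> - 1) G = n"
    using vertex_cover_number_add_independence_number[of G "\<delta> - 1"] fV GV \<open>card V = n\<close> by simp
  have "real (sd_number V k F) \<le> real n - real (independence_number (\<delta> - 1) G)"
    using a1 a2 by linarith
  also have "\<dots> \<le> real n - \<delta> / (d + \<delta>) * real n"
    using independence_number_ge[OF G \<delta>] GV V assms(2,8) by simp
  also have "\<dots> = d / (d + \<delta>) * real n"
    using d \<delta> by (simp add: field_simps)
  finally have le: "real (sd_number V k F) \<le> d / (d + \<delta>) * real n" .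
  \<comment> \<open>The map from \<open>D\<close> to \<open>D / (D + \<delta>)\<close> is increasing
    for nonnegative \<open>D\<close>. Parts (b) and (c) take for \<open>D\<close> the ceiling of
    \<open>d\<close> and \<open>k * \<delta>\<close>.\<close>
  have mono: "real (sd_number V k F) \<le> D / (D + \<delta>) * real n" if "d \<le> D" for D
  proof -
    have "d / (d + \<delta>) \<le> D / (D + \<delta>)"
      using that d \<delta> by (simp add: divide_simps) (simp add: algebra_simps mult_right_mono)
    then show ?thesis using le mult_right_mono[of _ _ "real n"] by fastforce
  qed
  have b: "real (sd_number V k F) \<le> (of_int \<lceil>d\<rceil> / (of_int \<lceil>d\<rceil> + real \<delta>)) * real n"
    by (rule mono) (rule le_of_int_ceiling)
  have c: "real (sd_number V k F) \<le> (real k / (real k + 1)) * real n"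
    if reg: "\<forall>i\<in>{1..k}. regular (F i) \<delta>"
  proof -
    have "d \<le> real (k * \<delta>)"
      unfolding assms(7,8) using reg by (intro average_degree_combined_graph_le fV F) auto
    from mono[OF this] have "real (sd_number V k F) \<le> real (k * \<delta>) / (real (k * \<delta>) + \<delta>) * real n" .
    also have "real (k * \<delta>) / (real (k * \<delta>) + \<delta>) = real k / (real k + 1)"
      using \<delta> mult_divide_mult_cancel_left[of "real \<delta>" "real k" "real k + 1"]
      by (simp add: algebra_simps)
    finally show ?thesis .
  qed
  show ?thesis using a1 a2 b c by auto
qed

end
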